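(* Let $\alpha\in[0,1)$. For any optimal assignment map $S\in Map[\ell,k]$, any $s\in\{1,\dots,k\}$ and any $j\in\{1,\dots,\ell\}$: if $$y_j\in\Big\{z\in\mathbb{R}^m:\min_{i\ne s}\|z-x_i\|<\rho_\alpha(1,n_j)\,\|z-x_s\|\Big\},$$ then $S(j)\ne s$; and if $$y_j\in\Big\{z\in\mathbb{R}^m:\|z-x_s\|<\rho_\alpha(1,n_j)\min_{i\ne s}\|z-x_i\|\Big\},$$ then $S(j)=s$.
   Context: $X\subset\mathbb{R}^m$ is compact and convex, $\|\cdot\|$ is the Euclidean norm, $\mathbf{x}=\{x_1,\dots,x_k\}\subset X$ is a set of $k$ points, $\mathbf{b}=\sum_{j=1}^\ell n_j\delta_{y_j}$ with $y_j\in X$, $n_j>0$, $\sum_j n_j=1$. For atomic measures $\mathbf{a},\mathbf{c}$ on $X$ of equal mass, a transport path from $\mathbf{a}$ to $\mathbf{c}$ is a weighted directed graph $G$ (without cycles) with finite vertex set $V(G)$ containing the atoms of $\mathbf{a}$ and $\mathbf{c}$, finite set $E(G)$ of directed edges which are line segments from $e^-$ to $e^+$, and weights $w:E(G)\to(0,\infty)$ such that for all $v\in V(G)$, $\sum_{e^-=v}w(e)=\sum_{e^+=v}w(e)+\mathbf{a}(\{v\})-\mathbf{c}(\{v\})$. $\mathbf{M}_\alpha(G)=\sum_{e\in E(G)}w(e)^\alpha\,length(e)$ and $d_\alpha(\mathbf{a},\mathbf{c})$ is the minimum of $\mathbf{M}_\alpha(G)$ over all transport paths from $\mathbf{a}$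 to $\mathbf{c}$ ($0$ for zero measures). $Map[\ell,k]$ is the set of functions $S:\{1,\dots,\ell\}\to\{1,\dots,k\}$. For such $S$, $\mathbf{a}_i=\big(\sum_{j\in S^{-1}(i)}n_j\big)\delta_{x_i}$, $\mathbf{b}_i=\sum_{j\in S^{-1}(i)}n_j\delta_{y_j}$, and $\mathbf{E}_\alpha(S;\mathbf{x},\mathbf{b})=\sum_{i=1}^kd_\alpha(\mathbf{a}_i,\mathbf{b}_i)$. $S$ is an optimal assignment map if it minimizes $\mathbf{E}_\alpha(\cdot\,;\mathbf{x},\mathbf{b})$ over $Map[\ell,k]$. For $\alpha\in(0,1)$ and $\sigma\ge\epsilon>0$, $\rho_\alpha(\sigma,\epsilon)=\left(\frac{\sigma}{\epsilon}\right)^\alpha-\left(\frac{\sigma}{\epsilon}-1\right)^\alpha$; for $\alpha=0$, $\rho_0(\sigma,\epsilon)=0$ if $\sigma>\epsilon>0$ and $\rho_0(\sigma,\epsilon)=1$ if $\sigma=\epsilon>0$. *)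

theory Defs
  imports "HOL-Analysis.Analysis"
begin

(* The Borel measure (SUM j : J. n j * delta_{y j}), as the push-forward under y of the measure
   on J with weights n; see emeasure_atomic_measure.  The points y j need not be distinct. *)
definition atomic_measure :: "nat set \<Rightarrow> (nat \<Rightarrow> real) \<Rightarrow> (nat \<Rightarrow> real ^ 'm) \<Rightarrow> (real ^ 'm) measure"
  where "atomic_measure J n y = distr (point_measure J (\<lambda>j. ennreal (n j))) borel y"

lemma emeasure_atomic_measure:
  assumes "finite J" and "A \<in> sets borel"
  shows "emeasure (atomic_measure J n y) A = (\<Sum>j\<in>J. ennreal (n j) * indicator A (y j))"
proof -
  have "emeasure (atomic_measure J n y) A =
      emeasure (point_measure J (\<lambda>j. ennreal (n j))) (y -` A \<inter> J)"
    unfolding atomic_measure_def using assms(2)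
    by (subst emeasure_distr) (simp_all add: space_point_measure)
  also have "\<dots> = (\<Sum>j\<in>y -` A \<inter> J. ennreal (n j))"
    using assms(1) by (intro emeasure_point_measure_finite) auto
  also have "\<dots> = (\<Sum>j\<in>J. ennreal (n j) * indicator A (y j))"
    using assms(1) by (intro sum.mono_neutral_cong_left) (auto simp: indicator_def)
  finally show ?thesis .
qed

definition atoms :: "(real ^ 'm) measure \<Rightarrow> (real ^ 'm) set"
  where "atoms a = {v. measure a {v} > 0}"

(* A directed edge is the pair (tail, head) = (e^-, e^+) of its end points. *)
definition transport_path ::
  "(real ^ 'm) measure \<Rightarrow> (real ^ 'm) measure \<Rightarrow>
   (real ^ 'm) set \<Rightarrow> ((real ^ 'm) \<times> (real ^ 'm)) set \<Rightarrow> ((real ^ 'm) \<times> (real ^ 'm) \<Rightarrow> real) \<Rightarrow> bool"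
  where "transport_path a c V E w \<longleftrightarrow>
    finite V \<and> atoms a \<subseteq> V \<and> atoms c \<subseteq> V \<and>
    E \<subseteq> V \<times> V \<and> acyclic E \<and> (\<forall>e\<in>E. w e > 0) \<and>
    (\<forall>v\<in>V. (\<Sum>e\<in>{e\<in>E. fst e = v}. w e) =
            (\<Sum>e\<in>{e\<in>E. snd e = v}. w e) + measure a {v} - measure c {v})"

(* Weights on E are positive, so for alpha = 0 each edge contributes its length. *)
definition M_cost :: "real \<Rightarrow> ((real ^ 'm) \<times> (real ^ 'm)) set \<Rightarrow> ((real ^ 'm) \<times> (real ^ 'm) \<Rightarrow> real) \<Rightarrow> real"
  where "M_cost \<alpha> E w = (\<Sum>e\<in>E. w e powr \<alpha> * dist (fst e) (snd e))"

(* The infimum is the minimum whenever it is attained.  The set is nonempty for finite atomic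
   measures of equal mass, and for zero measures the empty graph gives the value 0. *)
definition d_cost :: "real \<Rightarrow> (real ^ 'm) measure \<Rightarrow> (real ^ 'm) measure \<Rightarrow> real"
  where "d_cost \<alpha> a c = Inf {M_cost \<alpha> E w | V E w. transport_path a c V E w}"

definition Map_set :: "nat \<Rightarrow> nat \<Rightarrow> (nat \<Rightarrow> nat) set"
  where "Map_set l k = {1..l} \<rightarrow>\<^sub>E {1..k}"

definition fibre :: "nat \<Rightarrow> (nat \<Rightarrow> nat) \<Rightarrow> nat \<Rightarrow> nat set"
  where "fibre l S i = {j\<in>{1..l}. S j = i}"

definition E_cost ::
  "real \<Rightarrow> nat \<Rightarrow> nat \<Rightarrow> (nat \<Rightarrow> real ^ 'm) \<Rightarrow> (nat \<Rightarrow> real) \<Rightarrow> (nat \<Rightarrow> real ^ 'm) \<Rightarrow> (nat \<Rightarrow> nat) \<Rightarrow> real"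
  where "E_cost \<alpha> k l x n y S =
    (\<Sum>i=1..k. d_cost \<alpha> (atomic_measure {i} (\<lambda>_. \<Sum>j\<in>fibre l S i. n j) x)
                        (atomic_measure (fibre l S i) n y))"

definition optimal_assignment ::
  "real \<Rightarrow> nat \<Rightarrow> nat \<Rightarrow> (nat \<Rightarrow> real ^ 'm) \<Rightarrow> (nat \<Rightarrow> real) \<Rightarrow> (nat \<Rightarrow> real ^ 'm) \<Rightarrow> (nat \<Rightarrow> nat) \<Rightarrow> bool"
  where "optimal_assignment \<alpha> k l x n y S \<longleftrightarrow>
    S \<in> Map_set l k \<and> (\<forall>T\<in>Map_set l k. E_cost \<alpha> k l x n y S \<le> E_cost \<alpha> k l x n y T)"

(* Meant for 0 <= alpha < 1 and sigma >= epsilon > 0. *)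
definition rho :: "real \<Rightarrow> real \<Rightarrow> real \<Rightarrow> real"
  where "rho \<alpha> \<sigma> \<epsilon> =
    (if \<alpha> = 0 then (if \<sigma> = \<epsilon> then 1 else 0)
     else (\<sigma> / \<epsilon>) powr \<alpha> - (\<sigma> / \<epsilon> - 1) powr \<alpha>)"

(* min_{i in {1..k}, i ~= s} |z - x_i|, extended-real valued so that it is infinity for k = 1. *)
definition min_dist_except :: "nat \<Rightarrow> (nat \<Rightarrow> real ^ 'm) \<Rightarrow> nat \<Rightarrow> real ^ 'm \<Rightarrow> ereal"
  where "min_dist_except k x s z = (INF i\<in>{1..k} - {s}. ereal (norm (z - x i)))"

end

theory Submission
  imports Defs
begin

text \<open>Move \<open>j\<close> from the cluster of \<open>x\<^sub>s\<close> to that of another point \<open>x\<^sub>i\<close>. By concavity of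
  \<open>w \<mapsto> w\<^sup>\<alpha>\<close>, weight can be shifted between two directed paths with common ends without raising
  the cost until an edge disappears, so the paths leaving \<open>x\<^sub>s\<close> may be taken to be trees.
  In a tree, the path from \<open>x\<^sub>s\<close> to \<open>y\<^sub>j\<close> has weights between \<open>n\<^sub>j\<close> and \<open>1\<close>, and lowering them by
  \<open>n\<^sub>j\<close> saves at least \<open>(1 - (1 - n\<^sub>j)\<^sup>\<alpha>) \<parallel>y\<^sub>j - x\<^sub>s\<parallel> = n\<^sub>j\<^sup>\<alpha> \<rho>\<^sub>\<alpha>(1, n\<^sub>j) \<parallel>y\<^sub>j - x\<^sub>s\<parallel>\<close>. An additional edge
  from \<open>x\<^sub>i\<close> to \<open>y\<^sub>j\<close> costs at most \<open>n\<^sub>j\<^sup>\<alpha> \<parallel>y\<^sub>j - x\<^sub>i\<parallel>\<close>. Optimality compares the two amounts.\<close>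

section \<open>Concavity of powers and the factor \<open>rho\<close>\<close>

text \<open>The graph lies below its tangent at the weighted mean \<open>m\<close>, and averaging
  this bound over the two points gives concavity. The end point 0 is included, with
  \<open>0 powr \<alpha> = 0\<close> even for \<open>\<alpha> = 0\<close>; this matches the fact
  that an edge of weight 0 costs nothing.\<close>

lemma concave_on_powr:
  fixes \<alpha> :: real
  assumes "0 \<le> \<alpha>" "\<alpha> \<le> 1"
  shows "concave_on {0..} (\<lambda>w. w powr \<alpha>)"
proof -
  have main: "(1 - t) * x powr \<alpha> + t * y powr \<alpha> \<le> ((1 - t) * x + t * y) powr \<alpha>"
    if t: "0 < t" "t < 1" and xy: "0 \<le> x" "0 \<le> y" for t x y :: real
  proof -
    define m where "m = (1 - t) * x + t * y"
    show ?thesis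
    proof (cases "m = 0")
      case True
      then have "x = 0" "y = 0"
        using t xy unfolding m_def
        by (smt (verit) mult_nonneg_nonneg mult_pos_pos)+
      then show ?thesis by simp
    next
      case False
      have "0 \<le> m" using t xy by (simp add: m_def)
      with False have m: "0 < m" by simp
      \<comment> \<open>Tangent at \<open>m\<close>: this is Young's inequality \<open>z\<^sup>\<alpha> m\<^sup>1\<^sup>-\<^sup>\<alpha> \<le> \<alpha> z + (1 - \<alpha>) m\<close>.\<close>
      have tangent: "z powr \<alpha> \<le> m powr \<alpha> * (1 + \<alpha> * (z / m - 1))" if "0 \<le> z" for z
      proof (cases "z = 0")
        case True
        then show ?thesis using assms by simp
      next
        case False
        with that have z: "0 < z" by simp
        have "(z / m) powr \<alpha> * 1 powr (1 - \<alpha>) \<le> \<alpha> * (z / m) + (1 - \<alpha>) * 1"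
          using assms z m by (intro Youngs_inequality_0) auto
        then have "(z / m) powr \<alpha> \<le> 1 + \<alpha> * (z / m - 1)"
          by (simp add: algebra_simps)
        then have "m powr \<alpha> * (z / m) powr \<alpha> \<le> m powr \<alpha> * (1 + \<alpha> * (z / m - 1))"
          by (intro mult_left_mono) auto
        then show ?thesis using z m by (simp add: powr_divide)
      qed
      have "(1 - t) * x powr \<alpha> + t * y powr \<alpha> \<le>
          (1 - t) * (m powr \<alpha> * (1 + \<alpha> * (x / m - 1))) + t * (m powr \<alpha> * (1 + \<alpha> * (y / m - 1)))"
        using t xy tangent by (intro add_mono mult_left_mono) auto
      also have "\<dots> = m powr \<alpha> * (1 + \<alpha> * (((1 - t) * x + t * y) / m - 1))"
        by (simp add: algebra_simps add_divide_distrib diff_divide_distrib)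
      also have "\<dots> = m powr \<alpha>" using m by (simp flip: m_def)
      finally show ?thesis by (simp add: m_def)
    qed
  qed
  then show ?thesis
    unfolding concave_on_def by (intro convex_onI) (auto simp: algebra_simps)
qed

text \<open>Increments of a concave function over intervals of fixed length \<open>n\<close>
  decrease to the right, so in \<open>{0..1}\<close> the last interval has the smallest one.\<close>

lemma powr_diff_ge:
  fixes \<alpha> :: real
  assumes "0 \<le> \<alpha>" "\<alpha> \<le> 1" "0 \<le> n" "n \<le> w" "w \<le> 1"
  shows "1 - (1 - n) powr \<alpha> \<le> w powr \<alpha> - (w - n) powr \<alpha>"
proof (cases "n = 0")
  case False
  \<comment> \<open>\<open>L\<close> is the length of the interval from \<open>w - n\<close> to 1.
    Both \<open>w\<close> and \<open>1 - n\<close> are convex combinations of its end points, with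
    the weights \<open>t\<close> and \<open>1 - t\<close> exchanged, so adding the two concavity
    bounds eliminates \<open>t\<close>.\<close>
  define L where "L = 1 - w + n"
  define t where "t = n / L"
  have L: "0 < L" "n \<le> L" using assms False by (auto simp: L_def)
  have t: "0 \<le> t" "t \<le> 1" using L assms by (auto simp: t_def)
  have tL: "t * L = n" using L by (simp add: t_def)
  have conv: "(1 - u) * (w - n) powr \<alpha> + u * 1 powr \<alpha> \<le> ((1 - u) * (w - n) + u * 1) powr \<alpha>"
    if "0 \<le> u" "u \<le> 1" for u
    using concave_on_powr[OF assms(1,2)] assms that
      convex_onD[of "{0..}" "\<lambda>w. - (w powr \<alpha>)" u "w - n" 1]
    by (simp add: concave_on_def)
  have w: "(1 - t) * (w - n) + t * 1 = w"
    and n: "(1 - (1 - t)) * (w - n) + (1 - t) * 1 = 1 - n"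
    using tL by (simp_all add: L_def algebra_simps)
  have "(1 - t) * (w - n) powr \<alpha> + t \<le> w powr \<alpha>"
    using conv[of t] t unfolding w by simp
  moreover have "t * (w - n) powr \<alpha> + (1 - t) \<le> (1 - n) powr \<alpha>"
    using conv[of "1 - t"] t unfolding n by simp
  ultimately show ?thesis by (simp add: algebra_simps)
qed simp

text \<open>Concavity between 0 and \<open>a + b\<close>, with value 0 at 0, bounds the power of
  each summand below by its proportional share of \<open>(a + b) powr \<alpha>\<close>.\<close>

lemma powr_add_le:
  fixes \<alpha> :: real
  assumes "0 \<le> \<alpha>" "\<alpha> \<le> 1" "0 \<le> a" "0 \<le> b"
  shows "(a + b) powr \<alpha> \<le> a powr \<alpha> + b powr \<alpha>"
proof (cases "a + b = 0")
  case False
  then have s: "0 < a + b" using assms by simp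
  have conv: "u * (a + b) powr \<alpha> \<le> (u * (a + b)) powr \<alpha>" if "0 \<le> u" "u \<le> 1" for u
    using concave_on_powr[OF assms(1,2)] s that
      convex_onD[of "{0..}" "\<lambda>w. - (w powr \<alpha>)" u 0 "a + b"]
    by (simp add: concave_on_def)
  have "a / (a + b) * (a + b) powr \<alpha> + b / (a + b) * (a + b) powr \<alpha> \<le> a powr \<alpha> + b powr \<alpha>"
    using conv[of "a / (a + b)"] conv[of "b / (a + b)"] s assms by (intro add_mono) auto
  moreover have "a / (a + b) * (a + b) powr \<alpha> + b / (a + b) * (a + b) powr \<alpha> = (a + b) powr \<alpha>"
    using s by (simp flip: distrib_right add_divide_distrib)
  ultimately show ?thesis by simp
qed (use assms in auto)

text \<open>Clearing the denominators in \<open>rho\<close> produces the saving of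
  \<open>powr_diff_ge\<close>. The case \<open>\<alpha> = 0\<close> fits because
  \<open>0 powr 0 = 0\<close>: the right-hand side is 1 for \<open>n = 1\<close> and 0 for
  \<open>n < 1\<close>.\<close>

lemma rho_one_mult_powr:
  assumes "0 < n" "n \<le> 1"
  shows "rho \<alpha> 1 n * n powr \<alpha> = 1 - (1 - n) powr \<alpha>"
proof (cases "\<alpha> = 0")
  case False
  have "(1 / n - 1) * n = 1 - n" using assms by (simp add: field_simps)
  moreover have "0 \<le> 1 / n - 1" using assms by simp
  ultimately have "(1 / n - 1) powr \<alpha> * n powr \<alpha> = (1 - n) powr \<alpha>"
    using assms powr_mult[of "1 / n - 1" n \<alpha>] by simp
  moreover have "(1 / n) powr \<alpha> * n powr \<alpha> = 1"
    using assms by (simp add: powr_divide)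
  ultimately show ?thesis using False by (simp add: rho_def left_diff_distrib)
qed (use assms in \<open>auto simp: rho_def\<close>)

lemma rho_one_nonneg:
  assumes "0 < n" "n \<le> 1" "0 \<le> \<alpha>"
  shows "0 \<le> rho \<alpha> 1 n"
proof -
  have "(1 - n) powr \<alpha> \<le> 1 powr \<alpha>" using assms by (intro powr_mono2) auto
  then have "0 \<le> rho \<alpha> 1 n * n powr \<alpha>" using rho_one_mult_powr[OF assms(1,2)] by simp
  then show ?thesis using assms by (simp add: zero_le_mult_iff)
qed

section \<open>Divergence of edge weights and flows from a single source\<close>

text \<open>Outflow minus inflow, written as one sum over the edges so that it is visibly linear in
  \<open>w\<close>, which may also take negative values.\<close>

definition net :: "('a \<times> 'a) set \<Rightarrow> ('a \<times> 'a \<Rightarrow> real) \<Rightarrow> 'a \<Rightarrow> real"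
  where "net E w v = (\<Sum>e\<in>E. w e * (of_bool (fst e = v) - of_bool (snd e = v)))"

lemma net_eq_out_minus_in:
  assumes "finite E"
  shows "net E w v = (\<Sum>e\<in>{e\<in>E. fst e = v}. w e) - (\<Sum>e\<in>{e\<in>E. snd e = v}. w e)"
proof -
  have "(\<Sum>e\<in>{e\<in>E. P e}. w e) = (\<Sum>e\<in>E. w e * of_bool (P e))" for P
    using assms by (intro sum.mono_neutral_cong_left) auto
  then show ?thesis
    by (simp add: net_def right_diff_distrib sum_subtractf)
qed

lemma net_add: "net E (\<lambda>e. f e + g e) v = net E f v + net E g v"
  by (simp add: net_def distrib_right sum.distrib)

lemma net_mult: "net E (\<lambda>e. c * f e) v = c * net E f v"
  by (simp add: net_def sum_distrib_left mult.assoc)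

lemma net_uminus: "net E (\<lambda>e. - f e) v = - net E f v"
  using net_mult[of E "-1" f v] by simp

lemma net_diff: "net E (\<lambda>e. f e - g e) v = net E f v - net E g v"
  using net_add[of E f "\<lambda>e. - g e" v] by (simp add: net_uminus)

lemma net_mono_neutral:
  assumes "finite E" "F \<subseteq> E" "\<And>e. e \<in> E - F \<Longrightarrow> w e = 0" "\<And>e. e \<in> F \<Longrightarrow> w e = w' e"
  shows "net F w' v = net E w v"
  unfolding net_def using assms by (intro sum.mono_neutral_cong_left) auto

lemma net_of_bool:
  assumes "finite E" "P \<subseteq> E"
  shows "net E (\<lambda>e. of_bool (e \<in> P)) v = net P (\<lambda>_. 1) v"
  using assms by (intro net_mono_neutral[symmetric]) auto

lemma net_insert:
  assumes "finite E" "(p, q) \<notin> E"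
  shows "net (insert (p, q) E) w v = w (p, q) * (of_bool (p = v) - of_bool (q = v)) + net E w v"
  using assms by (simp add: net_def)

text \<open>The atoms of the target are recorded by the demand \<open>b\<close>; the vertex set is left implicit.\<close>

definition flow ::
  "real \<Rightarrow> 'a \<Rightarrow> ('a \<Rightarrow> real) \<Rightarrow> ('a \<times> 'a) set \<Rightarrow> ('a \<times> 'a \<Rightarrow> real) \<Rightarrow> bool"
  where "flow \<sigma> p b E w \<longleftrightarrow> finite E \<and> acyclic E \<and> (\<forall>e\<in>E. w e > 0) \<and>
    (\<forall>v. net E w v = \<sigma> * of_bool (v = p) - b v)"

text \<open>Away from \<open>p\<close>, inflow is at least outflow, so a vertex with an outgoing
  edge also has an incoming one. In a finite acyclic graph this walk backwards has to stop, and it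
  can stop only at \<open>p\<close>.\<close>

lemma flow_reachable:
  assumes F: "flow \<sigma> p b E w" and b: "\<And>v. 0 \<le> b v" and "(u, v) \<in> E"
  shows "(p, u) \<in> E\<^sup>*"
proof -
  have E: "finite E" "acyclic E" "\<And>e. e \<in> E \<Longrightarrow> w e > 0"
    using F by (auto simp: flow_def)
  have "wf E" using E by (simp add: finite_acyclic_wf)
  then show ?thesis using \<open>(u, v) \<in> E\<close>
  proof (induction u arbitrary: v rule: wf_induct_rule)
    case (less u)
    show ?case
    proof (cases "u = p")
      case False
      have "0 < w (u, v)" using E less.prems by blast
      also have "\<dots> \<le> (\<Sum>e\<in>{e\<in>E. fst e = u}. w e)"
        using E less.prems by (intro member_le_sum) (auto intro: less_imp_le)
      also have "\<dots> \<le> (\<Sum>e\<in>{e\<in>E. snd e = u}. w e)"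
        using F E b[of u] False net_eq_out_minus_in[of E w u] by (simp add: flow_def)
      finally have "{e\<in>E. snd e = u} \<noteq> {}" by (metis less_irrefl sum.empty)
      then obtain t where t: "(t, u) \<in> E" by auto
      with less.IH[OF t t] show ?thesis by simp
    qed simp
  qed
qed

text \<open>The tail of such an edge would be reachable from \<open>p\<close>, which closes a
  cycle.\<close>

lemma flow_no_edge_into_source:
  assumes "flow \<sigma> p b E w" "\<And>v. 0 \<le> b v"
  shows "(u, p) \<notin> E"
  using flow_reachable[OF assms] assms(1) unfolding flow_def acyclic_def
  by (meson rtrancl_into_trancl1)

text \<open>Changes of weight may bring edges down to 0; deleting these restores strict positivity
  and leaves the divergence as it was.\<close>

lemma flow_restrict:
  assumes "finite E" "acyclic E" "\<And>e. e \<in> E \<Longrightarrow> 0 \<le> w e"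
    and "\<And>v. net E w v = \<sigma> * of_bool (v = p) - b v"
  shows "flow \<sigma> p b {e\<in>E. 0 < w e} w"
proof -
  have "net {e\<in>E. 0 < w e} w v = net E w v" for v
    using assms by (intro net_mono_neutral) (auto simp: less_le)
  moreover have "acyclic {e\<in>E. 0 < w e}"
    using assms(2) by (rule acyclic_subset) auto
  ultimately show ?thesis using assms by (simp add: flow_def)
qed

lemma M_cost_restrict:
  assumes "finite E" "\<And>e. e \<in> E \<Longrightarrow> 0 \<le> w e"
  shows "M_cost \<alpha> {e\<in>E. 0 < w e} w = M_cost \<alpha> E w"
  unfolding M_cost_def using assms by (intro sum.mono_neutral_left) (auto simp: less_le)

section \<open>Paths, circulations and reduction to trees\<close>

text \<open>A path is recorded as its edge set, whose indicator has the divergence of one unit sent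
  from \<open>p\<close> to \<open>q\<close>. The reachability clause serves the induction: by
  acyclicity it keeps the next edge out of \<open>P\<close>. The length bound is the triangle
  inequality.\<close>

lemma path_exists:
  fixes E :: "('a::metric_space \<times> 'a) set"
  assumes "finite E" "acyclic E" "(p, q) \<in> E\<^sup>*"
  shows "\<exists>P\<subseteq>E. (\<forall>e\<in>P. (snd e, q) \<in> E\<^sup>*) \<and>
    (\<forall>v. net P (\<lambda>_. 1) v = of_bool (p = v) - of_bool (q = v)) \<and>
    dist p q \<le> (\<Sum>e\<in>P. dist (fst e) (snd e))"
  using assms(3)
proof (induction q rule: rtrancl_induct)
  case base
  show ?case by (rule exI[of _ "{}"]) (simp add: net_def)
next
  case (step q r)
  then obtain P where P: "P \<subseteq> E" "\<And>e. e \<in> P \<Longrightarrow> (snd e, q) \<in> E\<^sup>*"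
    "\<And>v. net P (\<lambda>_. 1) v = of_bool (p = v) - of_bool (q = v)"
    "dist p q \<le> (\<Sum>e\<in>P. dist (fst e) (snd e))"
    by blast
  have "finite P" using P(1) assms(1) by (rule finite_subset)
  have "(q, r) \<notin> P"
  proof
    assume "(q, r) \<in> P"
    then have "(r, q) \<in> E\<^sup>*" using P(2) by force
    with step(2) have "(q, q) \<in> E\<^sup>+" by (rule rtrancl_into_trancl2)
    then show False using assms(2) by (simp add: acyclic_def)
  qed
  moreover have "dist p r \<le> dist q r + dist p q"
    using dist_triangle[of p r q] by simp
  ultimately show ?case
    using P step(2) \<open>finite P\<close>
    by (intro exI[of _ "insert (q, r) P"])
      (auto simp: net_insert intro: rtrancl_into_rtrancl)
qed

text \<open>This is a ratio test: \<open>t\<close> is the first time at which a weight moving in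
  direction \<open>d\<close> vanishes.\<close>

lemma circulation_step:
  assumes "finite E" "\<And>e. e \<in> E \<Longrightarrow> 0 < w e" "e\<^sub>0 \<in> E" "d e\<^sub>0 < (0::real)"
  shows "\<exists>t>0. (\<forall>e\<in>E. 0 \<le> w e + t * d e) \<and> (\<exists>e\<in>E. w e + t * d e = 0)"
proof -
  define N where "N = {e\<in>E. d e < 0}"
  define t where "t = Min ((\<lambda>e. w e / - d e) ` N)"
  have N: "finite N" "N \<noteq> {}" using assms by (auto simp: N_def)
  then have "t \<in> (\<lambda>e. w e / - d e) ` N" unfolding t_def by (intro Min_in) auto
  then obtain e where e: "e \<in> N" "t = w e / - d e" by auto
  then have "0 < t" using assms(2)[of e] by (simp add: N_def divide_pos_neg)
  moreover have "w e + t * d e = 0" using e by (simp add: N_def)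
  ultimately have t: "0 < t" "w e + t * d e = 0" .
  have "0 \<le> w f + t * d f" if f: "f \<in> E" for f
  proof (cases "d f < 0")
    case True
    then have "t \<le> w f / - d f"
      unfolding t_def using N f by (intro Min_le) (auto simp: N_def)
    then show ?thesis using True by (simp add: field_simps)
  next
    case False
    then show ?thesis using t assms(2)[OF f] by simp
  qed
  moreover have "e \<in> E" using e by (simp add: N_def)
  ultimately show ?thesis using t by blast
qed

lemma M_cost_concave:
  assumes "0 \<le> \<alpha>" "\<alpha> \<le> 1" "0 \<le> t" "t \<le> 1"
    and "\<And>e. e \<in> E \<Longrightarrow> 0 \<le> f e" "\<And>e. e \<in> E \<Longrightarrow> 0 \<le> g e"
  shows "(1 - t) * M_cost \<alpha> E f + t * M_cost \<alpha> E g \<le> M_cost \<alpha> E (\<lambda>e. (1 - t) * f e + t * g e)"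
proof -
  have "(1 - t) * f e powr \<alpha> + t * g e powr \<alpha> \<le> ((1 - t) * f e + t * g e) powr \<alpha>"
    if "e \<in> E" for e
    using concave_on_powr[OF assms(1,2)] assms(3,4) assms(5,6)[OF that]
      convex_onD[of "{0..}" "\<lambda>w. - (w powr \<alpha>)" t "f e" "g e"]
    by (simp add: concave_on_def)
  then have "((1 - t) * f e powr \<alpha> + t * g e powr \<alpha>) * dist (fst e) (snd e)
      \<le> ((1 - t) * f e + t * g e) powr \<alpha> * dist (fst e) (snd e)" if "e \<in> E" for e
    using that by (intro mult_right_mono) auto
  then show ?thesis
    unfolding M_cost_def sum_distrib_left sum.distrib[symmetric]
    by (intro sum_mono) (simp add: distrib_right mult.assoc)
qed

text \<open>Moving along \<open>d\<close> and along \<open>- d\<close> until an edge vanishes gives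
  two flows with \<open>w\<close> on the segment between them. The cost is concave, so at one of the
  two it is no larger than at \<open>w\<close>.\<close>

lemma flow_cancel_circulation:
  fixes E :: "((real ^ 'm) \<times> (real ^ 'm)) set"
  assumes F: "flow \<sigma> p b E w" and \<alpha>: "0 \<le> \<alpha>" "\<alpha> \<le> 1"
    and d: "\<And>v. net E d v = 0"
    and e: "e\<^sub>1 \<in> E" "d e\<^sub>1 < 0" "e\<^sub>2 \<in> E" "0 < d e\<^sub>2"
  shows "\<exists>E' w'. E' \<subset> E \<and> flow \<sigma> p b E' w' \<and> M_cost \<alpha> E' w' \<le> M_cost \<alpha> E w"
proof -
  have E: "finite E" "acyclic E" "\<And>e. e \<in> E \<Longrightarrow> w e > 0"
    using F by (auto simp: flow_def)
  obtain t where t: "0 < t" "\<forall>e\<in>E. 0 \<le> w e + t * d e" "\<exists>e\<in>E. w e + t * d e = 0"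
    using circulation_step[of E w e\<^sub>1 d, OF E(1,3) e(1,2)] by blast
  obtain u where u: "0 < u" "\<forall>e\<in>E. 0 \<le> w e + u * - d e" "\<exists>e\<in>E. w e + u * - d e = 0"
    using circulation_step[of E w e\<^sub>2 "\<lambda>e. - d e", OF E(1,3) e(3)] e(4) by auto
  \<comment> \<open>The signed step \<open>c\<close> covers both directions: it will be
    \<open>t\<close> or \<open>- u\<close>.\<close>
  have *: ?thesis
    if c: "\<forall>e\<in>E. 0 \<le> w e + c * d e" "\<exists>e\<in>E. w e + c * d e = 0"
      "M_cost \<alpha> E (\<lambda>e. w e + c * d e) \<le> M_cost \<alpha> E w" for c
  proof -
    have "flow \<sigma> p b {e\<in>E. 0 < w e + c * d e} (\<lambda>e. w e + c * d e)"
      using F E c(1) d by (intro flow_restrict) (simp_all add: net_add net_mult flow_def)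
    moreover have "M_cost \<alpha> {e\<in>E. 0 < w e + c * d e} (\<lambda>e. w e + c * d e) \<le> M_cost \<alpha> E w"
      using c(1,3) E(1) by (subst M_cost_restrict) simp_all
    moreover obtain e where "e \<in> E" "\<not> 0 < w e + c * d e" using c(2) by auto
    then have "{e\<in>E. 0 < w e + c * d e} \<subset> E" by blast
    ultimately show ?thesis by blast
  qed
  \<comment> \<open>With this \<open>r\<close>, \<open>(1 - r) * t = r * u\<close>, so the
    displacements cancel and the combination of the two end flows is \<open>w\<close>.\<close>
  define r where "r = t / (t + u)"
  have r: "0 \<le> r" "r \<le> 1" "r < 1" using t u by (auto simp: r_def)
  have rtu: "r * (t + u) = t" using t u by (simp add: r_def)
  have "(1 - r) * (w e + t * d e) + r * (w e + u * - d e) = w e" for e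
  proof -
    have "(1 - r) * (w e + t * d e) + r * (w e + u * - d e) = w e + d e * (t - r * (t + u))"
      by (simp add: algebra_simps)
    then show ?thesis by (simp add: rtu)
  qed
  then have conc: "(1 - r) * M_cost \<alpha> E (\<lambda>e. w e + t * d e) + r * M_cost \<alpha> E (\<lambda>e. w e + u * - d e)
      \<le> M_cost \<alpha> E w"
    using M_cost_concave[OF \<alpha> r(1,2), of E "\<lambda>e. w e + t * d e" "\<lambda>e. w e + u * - d e"] t u by simp
  show ?thesis
  proof (cases "M_cost \<alpha> E (\<lambda>e. w e + t * d e) \<le> M_cost \<alpha> E w")
    case True
    with t show ?thesis by (intro *[of t])
  next
    case False
    have "M_cost \<alpha> E (\<lambda>e. w e + u * - d e) \<le> M_cost \<alpha> E w"
    proof (rule ccontr)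
      assume "\<not> ?thesis"
      with False have "(1 - r) * M_cost \<alpha> E w + r * M_cost \<alpha> E w <
          (1 - r) * M_cost \<alpha> E (\<lambda>e. w e + t * d e) + r * M_cost \<alpha> E (\<lambda>e. w e + u * - d e)"
        using r by (intro add_less_le_mono mult_strict_left_mono mult_left_mono) simp_all
      with conc show False by (simp add: left_diff_distrib)
    qed
    with u show ?thesis by (intro *[of "- u"]) simp_all
  qed
qed

text \<open>Injectivity of \<open>snd\<close> says that every in-degree is at most one, which
  together with reachability from \<open>p\<close> makes the graph a tree. If two edges enter
  \<open>v\<close>, paths from \<open>p\<close> to \<open>v\<close> through each of them differ by a
  circulation; cancelling it deletes an edge, and the induction is on the number of edges.\<close>

lemma flow_reduce_indegree:
  fixes E :: "((real ^ 'm) \<times> (real ^ 'm)) set"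
  assumes "flow \<sigma> p b E w" and \<alpha>: "0 \<le> \<alpha>" "\<alpha> \<le> 1" and b: "\<And>v. 0 \<le> b v"
  shows "\<exists>E' w'. flow \<sigma> p b E' w' \<and> inj_on snd E' \<and> M_cost \<alpha> E' w' \<le> M_cost \<alpha> E w"
  using assms(1)
proof (induction "card E" arbitrary: E w rule: less_induct)
  case less
  note F = \<open>flow \<sigma> p b E w\<close>
  have E: "finite E" "acyclic E" using F by (auto simp: flow_def)
  show ?case
  proof (cases "inj_on snd E")
    case False
    then obtain u u' v where uv: "(u, v) \<in> E" "(u', v) \<in> E" "u \<noteq> u'"
      unfolding inj_on_def by (metis prod.collapse)
    \<comment> \<open>The path enters \<open>v\<close> only through the chosen edge. Hence, however
      much \<open>P\<close> and \<open>Q\<close> overlap elsewhere, \<open>d\<close> is 1 on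
      \<open>(u, v)\<close> and -1 on \<open>(u', v)\<close>.\<close>
    have ext: "\<exists>P\<subseteq>E. (\<forall>t. (t, v) \<in> P \<longleftrightarrow> t = u) \<and>
        (\<forall>z. net P (\<lambda>_. 1) z = of_bool (p = z) - of_bool (v = z))"
      if e: "(u, v) \<in> E" for u
    proof -
      obtain P where P: "P \<subseteq> E" "\<And>e. e \<in> P \<Longrightarrow> (snd e, u) \<in> E\<^sup>*"
        "\<And>z. net P (\<lambda>_. 1) z = of_bool (p = z) - of_bool (u = z)"
        using path_exists[OF E flow_reachable[OF F b e]] by blast
      have "(t, v) \<notin> P" for t
      proof
        assume "(t, v) \<in> P"
        then have "(v, u) \<in> E\<^sup>*" using P(2) by force
        with e have "(u, u) \<in> E\<^sup>+" by (rule rtrancl_into_trancl2)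
        then show False using E by (simp add: acyclic_def)
      qed
      moreover have "finite P" using P(1) E(1) by (rule finite_subset)
      ultimately show ?thesis
        using P e by (intro exI[of _ "insert (u, v) P"]) (auto simp: net_insert)
    qed
    obtain P where P: "P \<subseteq> E" "\<And>t. (t, v) \<in> P \<longleftrightarrow> t = u"
      "\<And>z. net P (\<lambda>_. 1) z = of_bool (p = z) - of_bool (v = z)"
      using ext[OF uv(1)] by blast
    obtain Q where Q: "Q \<subseteq> E" "\<And>t. (t, v) \<in> Q \<longleftrightarrow> t = u'"
      "\<And>z. net Q (\<lambda>_. 1) z = of_bool (p = z) - of_bool (v = z)"
      using ext[OF uv(2)] by blast
    define d :: "(real ^ 'm) \<times> (real ^ 'm) \<Rightarrow> real"
      where "d = (\<lambda>e. of_bool (e \<in> P) - of_bool (e \<in> Q))"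
    have "net E d z = 0" for z
      unfolding d_def using P Q E by (simp add: net_diff net_of_bool)
    moreover have "d (u', v) < 0" "0 < d (u, v)"
      using P(2) Q(2) uv(3) by (auto simp: d_def)
    ultimately obtain E' w' where E': "E' \<subset> E" "flow \<sigma> p b E' w'"
      "M_cost \<alpha> E' w' \<le> M_cost \<alpha> E w"
      using flow_cancel_circulation[OF F \<alpha> _ uv(2) _ uv(1)] by blast
    with less.hyps[of E' w'] E show ?thesis
      by (meson order_trans psubset_card_mono)
  qed (use F in blast)
qed

section \<open>Edge weights in a tree, and removing or adding demand\<close>

lemma edges_into_eq_singleton:
  assumes "inj_on snd E" "(u, v) \<in> E"
  shows "{e\<in>E. snd e = v} = {(u, v)}"
proof -
  have "e = (u, v)" if "e \<in> E" "snd e = v" for e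
    using inj_onD[OF assms(1), of e "(u, v)"] assms(2) that by simp
  moreover have "(u, v) \<in> {e\<in>E. snd e = v}" using assms(2) by simp
  ultimately show ?thesis by blast
qed

text \<open>With in-degree one, the whole inflow of \<open>v\<close> comes through a single edge,
  whose weight is therefore at least \<open>n\<close>. Its tail is \<open>p\<close> or again has
  inflow at least \<open>n\<close>, and the argument repeats back to \<open>p\<close>.\<close>

lemma flow_path_of_large_weights:
  assumes F: "flow \<sigma> p b E w" and b: "\<And>v. 0 \<le> b v" and inj: "inj_on snd E"
    and n: "0 < n" and v: "v = p \<or> n \<le> (\<Sum>e\<in>{e\<in>E. snd e = v}. w e)"
  shows "(p, v) \<in> {e\<in>E. n \<le> w e}\<^sup>*"
proof -
  have E: "finite E" "acyclic E" "\<And>e. e \<in> E \<Longrightarrow> w e > 0"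
    using F by (auto simp: flow_def)
  have "wf E" using E by (simp add: finite_acyclic_wf)
  then show ?thesis using v
  proof (induction v rule: wf_induct_rule)
    case (less v)
    show ?case
    proof (cases "v = p")
      case False
      then have nv: "n \<le> (\<Sum>e\<in>{e\<in>E. snd e = v}. w e)" using less.prems by simp
      with n have "{e\<in>E. snd e = v} \<noteq> {}" by (metis sum.empty not_less)
      then obtain u where u: "(u, v) \<in> E" by auto
      then have "{e\<in>E. snd e = v} = {(u, v)}"
        by (rule edges_into_eq_singleton[OF inj])
      with nv have uv: "n \<le> w (u, v)" by simp
      have "u = p \<or> n \<le> (\<Sum>e\<in>{e\<in>E. snd e = u}. w e)"
      proof (cases "u = p")
        case False
        have "w (u, v) \<le> (\<Sum>e\<in>{e\<in>E. fst e = u}. w e)"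
          using E u by (intro member_le_sum) (auto intro: less_imp_le)
        moreover have "\<dots> \<le> (\<Sum>e\<in>{e\<in>E. snd e = u}. w e)"
          using F E b[of u] False net_eq_out_minus_in[of E w u] by (simp add: flow_def)
        ultimately show ?thesis using uv by simp
      qed simp
      with less.IH[OF u] have "(p, u) \<in> {e\<in>E. n \<le> w e}\<^sup>*" .
      moreover have "(u, v) \<in> {e\<in>E. n \<le> w e}" using u uv by simp
      ultimately show ?thesis by (rule rtrancl_into_rtrancl)
    qed simp
  qed
qed

text \<open>Weights do not decrease towards the root, since the only edge into a vertex carries
  everything that leaves it. At \<open>p\<close> nothing enters, so the outflow is
  \<open>\<sigma> - b p\<close>.\<close>

lemma flow_weight_le_total:
  assumes F: "flow \<sigma> p b E w" and b: "\<And>v. 0 \<le> b v" and inj: "inj_on snd E"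
    and "(u, v) \<in> E"
  shows "w (u, v) \<le> \<sigma>"
proof -
  have E: "finite E" "acyclic E" "\<And>e. e \<in> E \<Longrightarrow> w e > 0"
    using F by (auto simp: flow_def)
  have "wf E" using E by (simp add: finite_acyclic_wf)
  then show ?thesis using \<open>(u, v) \<in> E\<close>
  proof (induction u arbitrary: v rule: wf_induct_rule)
    case (less u)
    let ?in = "\<Sum>e\<in>{e\<in>E. snd e = u}. w e"
    have out: "w (u, v) \<le> (\<Sum>e\<in>{e\<in>E. fst e = u}. w e)"
      using E less.prems by (intro member_le_sum) (auto intro: less_imp_le)
    have bal: "(\<Sum>e\<in>{e\<in>E. fst e = u}. w e) - ?in = \<sigma> * of_bool (u = p) - b u"
      using F E net_eq_out_minus_in[of E w u] by (simp add: flow_def)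
    show ?case
    proof (cases "u = p")
      case True
      then have none: "{e\<in>E. snd e = u} = {}"
        using flow_no_edge_into_source[OF F b] by auto
      show ?thesis using out bal True b[of u] unfolding none by simp
    next
      case False
      have "0 < w (u, v)" using E less.prems by blast
      with out bal False b[of u] have pos: "0 < ?in" "w (u, v) \<le> ?in" by auto
      from pos(1) have "{e\<in>E. snd e = u} \<noteq> {}" by (metis sum.empty less_irrefl)
      then obtain t where t: "(t, u) \<in> E" by auto
      then have "{e\<in>E. snd e = u} = {(t, u)}"
        by (rule edges_into_eq_singleton[OF inj])
      with pos less.IH[OF t t] show ?thesis by simp
    qed
  qed
qed

text \<open>After passing to a tree, \<open>n\<close> is subtracted along a path from
  \<open>p\<close> to \<open>q\<close>. The weights there lie between \<open>n\<close> and
  \<open>\<sigma> \<le> 1\<close>, so \<open>powr_diff_ge\<close> gives the saving per unit length,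
  and the path is at least as long as the straight segment.\<close>

lemma flow_remove_demand:
  fixes E :: "((real ^ 'm) \<times> (real ^ 'm)) set"
  assumes "flow \<sigma> p b E w" and \<alpha>: "0 \<le> \<alpha>" "\<alpha> \<le> 1" and b: "\<And>v. 0 \<le> b v"
    and n: "0 < n" "n \<le> b q" and \<sigma>: "\<sigma> \<le> 1"
  shows "\<exists>E' w'. flow (\<sigma> - n) p (\<lambda>v. b v - n * of_bool (q = v)) E' w' \<and>
    M_cost \<alpha> E' w' + (1 - (1 - n) powr \<alpha>) * dist p q \<le> M_cost \<alpha> E w"
proof -
  obtain E\<^sub>1 w\<^sub>1 where F: "flow \<sigma> p b E\<^sub>1 w\<^sub>1" and inj: "inj_on snd E\<^sub>1"
    and le: "M_cost \<alpha> E\<^sub>1 w\<^sub>1 \<le> M_cost \<alpha> E w"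
    using flow_reduce_indegree[OF assms(1-3) b] by blast
  have E: "finite E\<^sub>1" "acyclic E\<^sub>1" "\<And>e. e \<in> E\<^sub>1 \<Longrightarrow> w\<^sub>1 e > 0"
    using F by (auto simp: flow_def)
  define H where "H = {e\<in>E\<^sub>1. n \<le> w\<^sub>1 e}"
  \<comment> \<open>Outflow is nonnegative, so unless \<open>q\<close> is the source its inflow
    alone covers the demand \<open>b q \<ge> n\<close>.\<close>
  have "0 \<le> (\<Sum>e\<in>{e\<in>E\<^sub>1. fst e = q}. w\<^sub>1 e)"
    using E by (intro sum_nonneg) (auto intro: less_imp_le)
  then have "q = p \<or> n \<le> (\<Sum>e\<in>{e\<in>E\<^sub>1. snd e = q}. w\<^sub>1 e)"
    using F E n(2) net_eq_out_minus_in[of E\<^sub>1 w\<^sub>1 q]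
    by (cases "q = p") (simp_all add: flow_def)
  then have "(p, q) \<in> H\<^sup>*"
    unfolding H_def by (rule flow_path_of_large_weights[OF F b inj n(1)])
  moreover have "finite H" "acyclic H" "H \<subseteq> E\<^sub>1"
    using E by (auto simp: H_def intro: acyclic_subset)
  ultimately obtain P where P: "P \<subseteq> H"
    "\<And>v. net P (\<lambda>_. 1) v = of_bool (p = v) - of_bool (q = v)"
    "dist p q \<le> (\<Sum>e\<in>P. dist (fst e) (snd e))"
    using path_exists[of H p q] by blast
  have w\<^sub>1: "w\<^sub>1 e \<le> 1" if "e \<in> E\<^sub>1" for e
    using flow_weight_le_total[OF F b inj, of "fst e" "snd e"] \<sigma> that by simp
  have PE: "P \<subseteq> E\<^sub>1" using P(1) by (auto simp: H_def)
  define w' where "w' = (\<lambda>e. w\<^sub>1 e - n * of_bool (e \<in> P))"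
  have w': "0 \<le> w' e" if "e \<in> E\<^sub>1" for e
    using E(3)[OF that] P(1) by (auto simp: w'_def H_def)
  have "net E\<^sub>1 w' v = (\<sigma> - n) * of_bool (v = p) - (b v - n * of_bool (q = v))" for v
    unfolding w'_def net_diff net_mult net_of_bool[OF E(1) PE] P(2)
    using F by (auto simp: flow_def algebra_simps)
  then have "flow (\<sigma> - n) p (\<lambda>v. b v - n * of_bool (q = v)) {e\<in>E\<^sub>1. 0 < w' e} w'"
    using E w' by (intro flow_restrict)
  moreover have "M_cost \<alpha> E\<^sub>1 w' + (1 - (1 - n) powr \<alpha>) * dist p q \<le> M_cost \<alpha> E\<^sub>1 w\<^sub>1"
  proof -
    have save: "(1 - (1 - n) powr \<alpha>) * of_bool (e \<in> P) \<le> w\<^sub>1 e powr \<alpha> - w' e powr \<alpha>"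
      if "e \<in> E\<^sub>1" for e
    proof (cases "e \<in> P")
      case True
      then have "n \<le> w\<^sub>1 e" using P(1) by (auto simp: H_def)
      then show ?thesis
        using powr_diff_ge[OF \<alpha>, of n "w\<^sub>1 e"] w\<^sub>1[OF that] n True by (simp add: w'_def)
    qed (simp add: w'_def)
    \<comment> \<open>The factor \<open>1 - (1 - n) powr \<alpha>\<close> has to be nonnegative
      unless \<open>P\<close> is empty, in which case \<open>dist p q = 0\<close>.\<close>
    have "n \<le> 1" if "e \<in> P" for e
      using w\<^sub>1[of e] that P(1) by (auto simp: H_def)
    then have "n \<le> 1 \<or> P = {}" by blast
    then have "(1 - (1 - n) powr \<alpha>) * dist p q
        \<le> (1 - (1 - n) powr \<alpha>) * (\<Sum>e\<in>P. dist (fst e) (snd e))"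
    proof
      assume "n \<le> 1"
      then have "(1 - n) powr \<alpha> \<le> 1 powr \<alpha>" using n \<alpha> by (intro powr_mono2) auto
      then show ?thesis using P(3) by (intro mult_left_mono) auto
    qed (use P(3) in auto)
    also have "\<dots> = (\<Sum>e\<in>E\<^sub>1. (1 - (1 - n) powr \<alpha>) * of_bool (e \<in> P) * dist (fst e) (snd e))"
      unfolding sum_distrib_left using E PE by (intro sum.mono_neutral_cong_left) auto
    also have "\<dots> \<le> (\<Sum>e\<in>E\<^sub>1. (w\<^sub>1 e powr \<alpha> - w' e powr \<alpha>) * dist (fst e) (snd e))"
      using save by (intro sum_mono mult_right_mono) auto
    also have "\<dots> = M_cost \<alpha> E\<^sub>1 w\<^sub>1 - M_cost \<alpha> E\<^sub>1 w'"
      by (simp add: M_cost_def left_diff_distrib sum_subtractf)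
    finally show ?thesis by simp
  qed
  moreover have "M_cost \<alpha> {e\<in>E\<^sub>1. 0 < w' e} w' = M_cost \<alpha> E\<^sub>1 w'"
    using E(1) w' by (rule M_cost_restrict)
  ultimately show ?thesis
    using le by (intro exI[of _ "{e\<in>E\<^sub>1. 0 < w' e}"] exI[of _ w']) simp
qed

text \<open>The extra mass travels along the straight edge from \<open>p\<close> to
  \<open>q\<close>. No cycle arises because no edge enters \<open>p\<close>, and if the edge is
  already present, subadditivity of the power bounds the increase.\<close>

lemma flow_add_demand:
  fixes E :: "((real ^ 'm) \<times> (real ^ 'm)) set"
  assumes F: "flow \<sigma> p b E w" and \<alpha>: "0 \<le> \<alpha>" "\<alpha> \<le> 1" and b: "\<And>v. 0 \<le> b v"
    and n: "0 < n"
  shows "\<exists>E' w'. flow (\<sigma> + n) p (\<lambda>v. b v + n * of_bool (q = v)) E' w' \<and>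
    M_cost \<alpha> E' w' \<le> M_cost \<alpha> E w + n powr \<alpha> * dist p q"
proof (cases "q = p")
  \<comment> \<open>For \<open>q = p\<close> the edge would be a loop; the additional supply and
    demand cancel at \<open>p\<close>, so the graph stays as it is.\<close>
  case True
  then have "flow (\<sigma> + n) p (\<lambda>v. b v + n * of_bool (q = v)) E w"
    using F by (auto simp: flow_def algebra_simps)
  then show ?thesis using True by auto
next
  case False
  have E: "finite E" "acyclic E" "\<And>e. e \<in> E \<Longrightarrow> w e > 0"
    using F by (auto simp: flow_def)
  define E' where "E' = insert (p, q) E"
  \<comment> \<open>Outside \<open>E\<close> the values of \<open>w\<close> are arbitrary, so
    \<open>w\<close> is cut off to 0 before \<open>n\<close> is added on
    \<open>(p, q)\<close>.\<close>
  define w\<^sub>0 where "w\<^sub>0 = (\<lambda>e. if e \<in> E then w e else 0)"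
  define w' where "w' = (\<lambda>e. w\<^sub>0 e + n * of_bool (e \<in> {(p, q)}))"
  have E': "finite E'" "E \<subseteq> E'" "{(p, q)} \<subseteq> E'" using E by (auto simp: E'_def)
  have "(q, p) \<notin> E\<^sup>*"
    using False flow_no_edge_into_source[OF F b] by (metis rtranclE)
  then have "acyclic E'" using E by (simp add: E'_def)
  moreover have "\<forall>e\<in>E'. 0 < w' e"
    using E n by (auto simp: E'_def w'_def w\<^sub>0_def add_pos_pos)
  moreover have "net E' w' v = (\<sigma> + n) * of_bool (v = p) - (b v + n * of_bool (q = v))" for v
  proof -
    have w\<^sub>0: "net E' w\<^sub>0 v = net E w v"
      using E' by (intro net_mono_neutral[symmetric]) (auto simp: w\<^sub>0_def)
    have pq: "net E' (\<lambda>e. of_bool (e \<in> {(p, q)})) v = of_bool (p = v) - of_bool (q = v)"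
      using E' by (subst net_of_bool) (auto simp: net_def)
    show ?thesis
      unfolding w'_def net_add net_mult w\<^sub>0 pq using F by (auto simp: flow_def algebra_simps)
  qed
  ultimately have "flow (\<sigma> + n) p (\<lambda>v. b v + n * of_bool (q = v)) E' w'"
    using E' by (simp add: flow_def)
  moreover have "M_cost \<alpha> E' w' \<le> M_cost \<alpha> E w + n powr \<alpha> * dist p q"
  proof -
    have "w' e powr \<alpha> \<le> w\<^sub>0 e powr \<alpha> + n powr \<alpha> * of_bool (e \<in> {(p, q)})" for e
      using powr_add_le[OF \<alpha>, of "w\<^sub>0 e" n] E(3)[of e] n by (auto simp: w'_def w\<^sub>0_def)
    then have "M_cost \<alpha> E' w' \<le>
        (\<Sum>e\<in>E'. (w\<^sub>0 e powr \<alpha> + n powr \<alpha> * of_bool (e \<in> {(p, q)})) * dist (fst e) (snd e))"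
      unfolding M_cost_def by (intro sum_mono mult_right_mono) auto
    also have "\<dots> = M_cost \<alpha> E' w\<^sub>0 +
        (\<Sum>e\<in>E'. n powr \<alpha> * of_bool (e \<in> {(p, q)}) * dist (fst e) (snd e))"
      by (simp add: M_cost_def distrib_right sum.distrib)
    also have "M_cost \<alpha> E' w\<^sub>0 = M_cost \<alpha> E w"
      unfolding M_cost_def using E' by (intro sum.mono_neutral_cong_right) (auto simp: w\<^sub>0_def)
    also have "(\<Sum>e\<in>E'. n powr \<alpha> * of_bool (e \<in> {(p, q)}) * dist (fst e) (snd e)) =
        (\<Sum>e\<in>{(p, q)}. n powr \<alpha> * dist (fst e) (snd e))"
      using E' by (intro sum.mono_neutral_cong_right) auto
    finally show ?thesis by simp
  qed
  ultimately show ?thesis by blast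
qed

section \<open>Transport from one atom to an atomic measure, expressed by flows\<close>

definition demand :: "nat set \<Rightarrow> (nat \<Rightarrow> real) \<Rightarrow> (nat \<Rightarrow> real ^ 'm) \<Rightarrow> real ^ 'm \<Rightarrow> real"
  where "demand J n y v = (\<Sum>j\<in>J. n j * of_bool (y j = v))"

lemma demand_nonneg: "(\<And>j. j \<in> J \<Longrightarrow> 0 \<le> n j) \<Longrightarrow> 0 \<le> demand J n y v"
  by (simp add: demand_def sum_nonneg)

lemma measure_atomic_measure_singleton:
  assumes "finite J" "\<And>j. j \<in> J \<Longrightarrow> 0 \<le> n j"
  shows "measure (atomic_measure J n y) {v} = demand J n y v"
proof -
  have "emeasure (atomic_measure J n y) {v} = (\<Sum>j\<in>J. ennreal (n j * of_bool (y j = v)))"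
    unfolding emeasure_atomic_measure[OF assms(1), of "{v}" n y, simplified]
    by (intro sum.cong) (auto simp: indicator_def)
  also have "\<dots> = ennreal (demand J n y v)"
    unfolding demand_def using assms by (intro sum_ennreal) auto
  finally show ?thesis
    using demand_nonneg[of J n y v] assms(2) by (simp add: measure_def)
qed

lemma demand_insert:
  assumes "finite J" "j \<notin> J"
  shows "demand (insert j J) n y = (\<lambda>v. demand J n y v + n j * of_bool (y j = v))"
  using assms by (auto simp: demand_def fun_eq_iff)

definition flow_costs ::
  "real \<Rightarrow> real ^ 'm \<Rightarrow> nat set \<Rightarrow> (nat \<Rightarrow> real) \<Rightarrow> (nat \<Rightarrow> real ^ 'm) \<Rightarrow> real set"
  where "flow_costs \<alpha> p J n y = {M_cost \<alpha> E w | E w. flow (sum n J) p (demand J n y) E w}"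

text \<open>For fixed edges and weights, a suitable vertex set exists exactly when the balance holds
  everywhere: outside \<open>V\<close> there are neither edges nor atoms, and conversely the end
  points of the edges together with the atoms form a finite \<open>V\<close>.\<close>

lemma d_cost_eq_Inf_flow_costs:
  assumes J: "finite J" and n: "\<And>j. j \<in> J \<Longrightarrow> 0 \<le> n j"
  shows "d_cost \<alpha> (atomic_measure {i} (\<lambda>_. sum n J) x) (atomic_measure J n y) =
    Inf (flow_costs \<alpha> (x i) J n y)"
proof -
  define a where "a = atomic_measure {i} (\<lambda>_. sum n J) x"
  define c where "c = atomic_measure J n y"
  have a: "measure a {v} = sum n J * of_bool (v = x i)" for v
    unfolding a_def using n
    by (subst measure_atomic_measure_singleton) (auto simp: demand_def sum_nonneg)
  have c: "measure c {v} = demand J n y v" for v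
    unfolding c_def using J n by (rule measure_atomic_measure_singleton)
  have "(\<exists>V. transport_path a c V E w) \<longleftrightarrow> flow (sum n J) (x i) (demand J n y) E w" for E w
  proof
    assume "\<exists>V. transport_path a c V E w"
    then obtain V where V: "finite V" "atoms a \<subseteq> V" "atoms c \<subseteq> V" "E \<subseteq> V \<times> V" "acyclic E"
      "\<forall>e\<in>E. w e > 0" "\<forall>v\<in>V. (\<Sum>e\<in>{e\<in>E. fst e = v}. w e) =
            (\<Sum>e\<in>{e\<in>E. snd e = v}. w e) + measure a {v} - measure c {v}"
      unfolding transport_path_def by blast
    have E: "finite E" using V by (meson finite_SigmaI finite_subset)
    have "net E w v = measure a {v} - measure c {v}" for v
    proof (cases "v \<in> V")
      case True
      then show ?thesis using V E by (simp add: net_eq_out_minus_in)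
    next
      case False
      then have "\<not> 0 < measure a {v}" "\<not> 0 < measure c {v}"
        using V(2,3) by (auto simp: atoms_def)
      then have "measure a {v} = 0" "measure c {v} = 0"
        by (simp_all add: zero_less_measure_iff)
      moreover have none: "{e\<in>E. fst e = v} = {}" "{e\<in>E. snd e = v} = {}"
        using False V(4) by auto
      ultimately show ?thesis by (simp add: net_eq_out_minus_in[OF E] none)
    qed
    then show "flow (sum n J) (x i) (demand J n y) E w"
      using V E by (simp add: flow_def a c)
  next
    assume F: "flow (sum n J) (x i) (demand J n y) E w"
    define V where "V = fst ` E \<union> snd ` E \<union> atoms a \<union> atoms c"
    have "atoms a \<subseteq> {x i}" by (auto simp: atoms_def a)
    moreover have "demand J n y v = 0" if "v \<notin> y ` J" for v
      unfolding demand_def using that by (intro sum.neutral) auto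
    then have "atoms c \<subseteq> y ` J" by (force simp: atoms_def c)
    ultimately have "finite V"
      using J F by (auto simp: V_def flow_def intro: finite_subset)
    moreover have "E \<subseteq> V \<times> V" by (force simp: V_def)
    moreover have "(\<Sum>e\<in>{e\<in>E. fst e = v}. w e) =
        (\<Sum>e\<in>{e\<in>E. snd e = v}. w e) + measure a {v} - measure c {v}" for v
      using F net_eq_out_minus_in[of E w v] by (simp add: a c flow_def)
    moreover have "atoms a \<subseteq> V" "atoms c \<subseteq> V" by (auto simp: V_def)
    ultimately have "transport_path a c V E w"
      using F by (simp add: transport_path_def flow_def)
    then show "\<exists>V. transport_path a c V E w" ..
  qed
  then show ?thesis
    unfolding d_cost_def flow_costs_def a_def[symmetric] c_def[symmetric]
    by (metis (lifting))
qed

lemma flow_costs_bdd_below: "bdd_below (flow_costs \<alpha> p J n y)"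
  unfolding flow_costs_def M_cost_def
  by (intro bdd_belowI[of _ 0]) (auto intro!: sum_nonneg)

lemma flow_costs_insert:
  assumes J: "finite J" "j \<notin> J" and n: "\<And>i. i \<in> insert j J \<Longrightarrow> 0 < n i"
    and \<alpha>: "0 \<le> \<alpha>" "\<alpha> \<le> 1" and "c \<in> flow_costs \<alpha> p J n y"
  shows "\<exists>c'\<in>flow_costs \<alpha> p (insert j J) n y. c' \<le> c + n j powr \<alpha> * dist p (y j)"
proof -
  obtain E w where F: "flow (sum n J) p (demand J n y) E w" and c: "c = M_cost \<alpha> E w"
    using assms(6) by (auto simp: flow_costs_def)
  have "\<And>v. 0 \<le> demand J n y v" using n by (intro demand_nonneg) (simp add: less_imp_le)
  from flow_add_demand[OF F \<alpha> this, of "n j" "y j"] show ?thesis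
    using n J by (auto simp: flow_costs_def c demand_insert add.commute)
qed

lemma flow_costs_remove:
  assumes J: "finite J" "j \<notin> J" and n: "\<And>i. i \<in> insert j J \<Longrightarrow> 0 < n i"
    and \<alpha>: "0 \<le> \<alpha>" "\<alpha> \<le> 1" and "sum n (insert j J) \<le> 1"
    and "c \<in> flow_costs \<alpha> p (insert j J) n y"
  shows "\<exists>c'\<in>flow_costs \<alpha> p J n y. c' + (1 - (1 - n j) powr \<alpha>) * dist p (y j) \<le> c"
proof -
  obtain E w where F: "flow (sum n (insert j J)) p (demand (insert j J) n y) E w"
    and c: "c = M_cost \<alpha> E w"
    using assms(7) by (auto simp: flow_costs_def)
  have b: "\<And>v. 0 \<le> demand (insert j J) n y v"
    using n by (intro demand_nonneg) (simp add: less_imp_le)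
  have "0 \<le> demand J n y (y j)" using n by (intro demand_nonneg) (simp add: less_imp_le)
  then have "n j \<le> demand (insert j J) n y (y j)" using J by (simp add: demand_insert)
  from flow_remove_demand[OF F \<alpha> b _ this assms(6)] show ?thesis
    using n J by (auto simp: flow_costs_def c demand_insert)
qed

text \<open>Starting from the empty graph, the points are served one after another; nonemptiness is
  what makes the infima meaningful.\<close>

lemma flow_costs_nonempty:
  assumes "finite J" "\<And>j. j \<in> J \<Longrightarrow> 0 < n j" "0 \<le> \<alpha>" "\<alpha> \<le> 1"
  shows "flow_costs \<alpha> p J n y \<noteq> {}"
  using assms(1,2)
proof (induction J rule: finite_induct)
  case empty
  have "flow (sum n {}) p (demand {} n y) {} w" for w
    by (auto simp: flow_def demand_def net_def acyclic_def)
  then show ?case unfolding flow_costs_def by blast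
next
  case (insert j J)
  then show ?case
    using flow_costs_insert[OF insert.hyps(1,2) insert.prems assms(3,4)] by fastforce
qed

text \<open>Infima are compared through their elements, so the argument does not rely on attained
  minima. A negative \<open>r\<close> expresses a saving.\<close>

lemma Inf_le_Inf_add:
  fixes A B :: "real set"
  assumes "A \<noteq> {}" "bdd_below B" "\<And>a. a \<in> A \<Longrightarrow> \<exists>b\<in>B. b \<le> a + r"
  shows "Inf B \<le> Inf A + r"
proof -
  have "Inf B - r \<le> Inf A"
  proof (rule cInf_greatest[OF assms(1)])
    fix a assume "a \<in> A"
    then obtain b where "b \<in> B" "b \<le> a + r" using assms(3) by blast
    with cInf_lower[OF \<open>b \<in> B\<close> assms(2)] show "Inf B - r \<le> a" by simp
  qed
  then show ?thesis by simp
qed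

section \<open>Reassigning one point and using optimality\<close>

text \<open>The competitor \<open>T\<close> differs from \<open>S\<close> only at \<open>j\<close>,
  so only the clusters of \<open>S j\<close> and \<open>i\<close> change cost. The first saves what
  \<open>flow_costs_remove\<close> gives, the second pays at most what
  \<open>flow_costs_insert\<close> gives, and optimality forbids a net gain.\<close>

lemma optimal_assignment_dist_le:
  fixes x y :: "nat \<Rightarrow> real ^ 'm"
  assumes opt: "optimal_assignment \<alpha> k l x n y S"
    and \<alpha>: "0 \<le> \<alpha>" "\<alpha> \<le> 1"
    and n: "\<And>i. i \<in> {1..l} \<Longrightarrow> 0 < n i" and n1: "sum n {1..l} = 1"
    and j: "j \<in> {1..l}" and i: "i \<in> {1..k}" "i \<noteq> S j"
  shows "rho \<alpha> 1 (n j) * norm (y j - x (S j)) \<le> norm (y j - x i)"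
proof -
  define D where "D T h = Inf (flow_costs \<alpha> (x h) (fibre l T h) n y)" for T h
  have fib: "finite (fibre l T h)" "fibre l T h \<subseteq> {1..l}" for T h
    by (auto simp: fibre_def)
  have pos: "0 < n h" if "h \<in> fibre l U g" for U g h
    using fib(2) n that by blast
  have E_cost: "E_cost \<alpha> k l x n y T = (\<Sum>h=1..k. D T h)" for T
    unfolding E_cost_def D_def using fib pos
    by (intro sum.cong refl d_cost_eq_Inf_flow_costs) (auto intro: less_imp_le)
  define s where "s = S j"
  define T where "T = S(j := i)"
  have S: "S \<in> Map_set l k" using opt by (simp add: optimal_assignment_def)
  then have s: "s \<in> {1..k}" "i \<noteq> s" using j i by (auto simp: Map_set_def s_def)
  have "T \<in> Map_set l k"
    using S i j by (auto simp: Map_set_def T_def PiE_iff extensional_def)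
  then have "(\<Sum>h=1..k. D S h) \<le> (\<Sum>h=1..k. D T h)"
    using opt by (simp add: optimal_assignment_def E_cost)
  moreover have "fibre l T h = fibre l S h" if "h \<notin> {s, i}" for h
    using that by (auto simp: fibre_def T_def s_def)
  then have "(\<Sum>h\<in>{1..k} - {s, i}. D S h) = (\<Sum>h\<in>{1..k} - {s, i}. D T h)"
    by (intro sum.cong) (auto simp: D_def)
  moreover have "(\<Sum>h=1..k. D U h) = (\<Sum>h\<in>{1..k} - {s, i}. D U h) + (D U s + D U i)" for U
    using s i by (subst sum.subset_diff[of "{s, i}"]) auto
  ultimately have opt2: "D S s + D S i \<le> D T s + D T i" by simp

  have Ss: "fibre l S s = insert j (fibre l T s)" "j \<notin> fibre l T s"
    using j s by (auto simp: fibre_def T_def s_def)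
  have Ti: "fibre l T i = insert j (fibre l S i)" "j \<notin> fibre l S i"
    using j s by (auto simp: fibre_def T_def s_def)
  have "sum n (fibre l S s) \<le> sum n {1..l}"
    using fib n by (intro sum_mono2) (auto intro: less_imp_le)
  then have le1: "sum n (insert j (fibre l T s)) \<le> 1" using n1 Ss(1) by simp
  have pos_s: "0 < n h" if "h \<in> insert j (fibre l T s)" for h
    using pos[of h S s] that Ss(1) by simp
  have pos_i: "0 < n h" if "h \<in> insert j (fibre l S i)" for h
    using pos[of h T i] that Ti(1) by simp
  have "D T s \<le> D S s + - ((1 - (1 - n j) powr \<alpha>) * dist (x s) (y j))"
    unfolding D_def Ss(1)
  proof (intro Inf_le_Inf_add flow_costs_bdd_below flow_costs_nonempty \<alpha>)
    show "\<exists>b\<in>flow_costs \<alpha> (x s) (fibre l T s) n y.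
        b \<le> a + - ((1 - (1 - n j) powr \<alpha>) * dist (x s) (y j))"
      if "a \<in> flow_costs \<alpha> (x s) (insert j (fibre l T s)) n y" for a
      using flow_costs_remove[OF fib(1) Ss(2) pos_s \<alpha> le1 that] by (force simp: algebra_simps)
  qed (use fib pos_s in auto)
  moreover have "D T i \<le> D S i + n j powr \<alpha> * dist (x i) (y j)"
    unfolding D_def Ti(1)
  proof (intro Inf_le_Inf_add flow_costs_bdd_below flow_costs_nonempty \<alpha>)
    show "\<exists>b\<in>flow_costs \<alpha> (x i) (insert j (fibre l S i)) n y.
        b \<le> a + n j powr \<alpha> * dist (x i) (y j)"
      if "a \<in> flow_costs \<alpha> (x i) (fibre l S i) n y" for a
      using fib(1) Ti(2) pos_i \<alpha> that by (rule flow_costs_insert)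
  qed (use fib pos_i in auto)
  ultimately have *: "(1 - (1 - n j) powr \<alpha>) * dist (x s) (y j) \<le> n j powr \<alpha> * dist (x i) (y j)"
    using opt2 by simp
  have "n j \<le> sum n {1..l}"
    using j n by (intro member_le_sum) (auto intro: less_imp_le)
  then have nj: "0 < n j" "n j \<le> 1" using n[OF j] n1 by simp_all
  \<comment> \<open>By \<open>rho_one_mult_powr\<close> the saving contains the factor
    \<open>n j powr \<alpha>\<close>, which is positive and cancels.\<close>
  have "n j powr \<alpha> * (rho \<alpha> 1 (n j) * dist (x s) (y j)) \<le> n j powr \<alpha> * dist (x i) (y j)"
    using * rho_one_mult_powr[OF nj, of \<alpha>] by (simp add: mult.assoc[symmetric] mult.commute)
  then have "rho \<alpha> 1 (n j) * dist (x s) (y j) \<le> dist (x i) (y j)"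
    using nj by simp
  then show ?thesis by (simp add: s_def dist_norm norm_minus_commute)
qed

theorem corollary4p1:
  fixes X :: "(real ^ 'm) set"
    and x y :: "nat \<Rightarrow> real ^ 'm"
    and n :: "nat \<Rightarrow> real"
    and k l s j :: nat
    and S :: "nat \<Rightarrow> nat"
    and \<alpha> :: real
  assumes "compact X" and "convex X"
    and "x ` {1..k} \<subseteq> X" and "inj_on x {1..k}"
    and "y ` {1..l} \<subseteq> X"
    and "\<forall>i\<in>{1..l}. n i > 0" and "(\<Sum>i=1..l. n i) = 1"
    and "0 \<le> \<alpha>" and "\<alpha> < 1"
    and "optimal_assignment \<alpha> k l x n y S"
    and "s \<in> {1..k}" and "j \<in> {1..l}"
  shows "(y j \<in> {z. min_dist_except k x s z < ereal (rho \<alpha> 1 (n j)) * ereal (norm (z - x s))}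
            \<longrightarrow> S j \<noteq> s) \<and>
         (y j \<in> {z. ereal (norm (z - x s)) < ereal (rho \<alpha> 1 (n j)) * min_dist_except k x s z}
            \<longrightarrow> S j = s)"
proof -
  have n: "\<And>i. i \<in> {1..l} \<Longrightarrow> 0 < n i" and n1: "sum n {1..l} = 1"
    using assms(6,7) by simp_all
  have \<alpha>: "0 \<le> \<alpha>" "\<alpha> \<le> 1" using assms(8,9) by simp_all
  have le: "rho \<alpha> 1 (n j) * norm (y j - x (S j)) \<le> norm (y j - x i)"
    if "i \<in> {1..k}" "i \<noteq> S j" for i
    using assms(10) \<alpha> n n1 assms(12) that by (rule optimal_assignment_dist_le)
  have Sj: "S j \<in> {1..k}"
    using assms(10,12) by (auto simp: optimal_assignment_def Map_set_def)
  have "n j \<le> sum n {1..l}"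
    using assms(12) n by (intro member_le_sum) (auto intro: less_imp_le)
  then have nj: "0 < n j" "n j \<le> 1" using n[OF assms(12)] n1 by simp_all
  have rho: "0 \<le> rho \<alpha> 1 (n j)" using rho_one_nonneg[OF nj \<alpha>(1)] .
  show ?thesis
  proof (intro conjI impI)
    assume "y j \<in> {z. min_dist_except k x s z < ereal (rho \<alpha> 1 (n j)) * ereal (norm (z - x s))}"
    then have "\<exists>i\<in>{1..k} - {s}. norm (y j - x i) < rho \<alpha> 1 (n j) * norm (y j - x s)"
      by (simp add: min_dist_except_def INF_less_iff)
    then obtain i where i: "i \<in> {1..k} - {s}"
      and "norm (y j - x i) < rho \<alpha> 1 (n j) * norm (y j - x s)" by blast
    with le[of i] show "S j \<noteq> s" by force
  next
    assume *: "y j \<in> {z. ereal (norm (z - x s)) < ereal (rho \<alpha> 1 (n j)) * min_dist_except k x s z}"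
    show "S j = s"
    proof (rule ccontr)
      assume "S j \<noteq> s"
      \<comment> \<open>Since \<open>S j\<close> differs from \<open>s\<close>, it is one of the
        indices of the infimum, which is therefore finite here.\<close>
      then have "min_dist_except k x s (y j) \<le> ereal (norm (y j - x (S j)))"
        unfolding min_dist_except_def using Sj by (intro INF_lower) auto
      then have "ereal (rho \<alpha> 1 (n j)) * min_dist_except k x s (y j)
          \<le> ereal (rho \<alpha> 1 (n j)) * ereal (norm (y j - x (S j)))"
        using rho by (intro ereal_mult_left_mono) auto
      \<comment> \<open>The distance bound is applied with \<open>s\<close> as the new cluster for
        \<open>j\<close>.\<close>
      also have "\<dots> \<le> ereal (norm (y j - x s))"
        using le[OF assms(11)] \<open>S j \<noteq> s\<close> by simp
      finally show False using * by simp
    qed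
  qed
qed

end
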